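(* Let $T$ be a rooted homogeneous tree of order $\gamma$ and let $B$ be the backward shift on $\mathcal{L}$. Then, for every $n\in\mathbb{N}$, $\|B^n\|=n+1$ if $\gamma=1$, and $\|B^n\|=(2n+1)\gamma^n-2n\gamma^{n-1}$ if $\gamma\ge 2$.
   Context: $\mathbb{N}=\{1,2,\dots\}$. A tree is an undirected graph (no loops or multiple edges) in which any two vertices are joined by exactly one path; $T$ also denotes its vertex set, which is assumed countably infinite, and every vertex has finite degree. $T$ has a distinguished vertex $o$, the root. For $v\neq o$, the parent $\mathrm{par}(v)$ is the vertex preceding $v$ on the unique path from $o$ to $v$; $\mathrm{Chi}(v)$ is the set of children of $v$ (vertices with parent $v$), and $\gamma(v)$ is its cardinality. $T$ is homogeneous of order $\gamma$ if $\gamma(v)=\gamma$ for all $v\in T$ (so $\gamma\geq 1$). For $f:T\to\mathbb{C}$ define $f'(o)=f(o)$ and $f'(v)=f(v)-f(\mathrm{par}(v))$ for $v\neq o$. The Lipschitz space $\mathcal{L}$ is the Banach space of all $f:T\to\mathbb{C}$ with $f'$ bounded, with norm $\|f\|=\sup_{v\in T}|f'(v)|$. The backward shift is $(Bf)(v)=\sum_{w\in\mathrm{Chi}(v)}f(w)$. *)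

theory Defs
  imports "HOL-Analysis.Analysis"
begin

text \<open>
  An undirected graph without loops or multiple edges is a symmetric irreflexive adjacency
  relation \<open>E\<close>; the vertex set is the whole type \<open>'v\<close>.
\<close>

definition path_between :: "('v \<Rightarrow> 'v \<Rightarrow> bool) \<Rightarrow> 'v \<Rightarrow> 'v \<Rightarrow> 'v list \<Rightarrow> bool" where
  "path_between E u v p \<longleftrightarrow>
     p \<noteq> [] \<and> hd p = u \<and> last p = v \<and> distinct p \<and> successively E p"

definition is_tree :: "('v \<Rightarrow> 'v \<Rightarrow> bool) \<Rightarrow> bool" where
  "is_tree E \<longleftrightarrow> symp E \<and> irreflp E \<and> (\<forall>u v. \<exists>!p. path_between E u v p)"

definition loc_finite_inf_tree :: "('v \<Rightarrow> 'v \<Rightarrow> bool) \<Rightarrow> bool" where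
  "loc_finite_inf_tree E \<longleftrightarrow>
     is_tree E \<and> countable (UNIV :: 'v set) \<and> infinite (UNIV :: 'v set) \<and>
     (\<forall>v. finite {w. E v w})"

text \<open>In what follows \<open>rt\<close> is the root; \<open>parent E rt rt\<close> is meaningless and never used.\<close>

definition parent :: "('v \<Rightarrow> 'v \<Rightarrow> bool) \<Rightarrow> 'v \<Rightarrow> 'v \<Rightarrow> 'v" where
  "parent E rt v = last (butlast (THE p. path_between E rt v p))"

definition children :: "('v \<Rightarrow> 'v \<Rightarrow> bool) \<Rightarrow> 'v \<Rightarrow> 'v \<Rightarrow> 'v set" where
  "children E rt v = {w. w \<noteq> rt \<and> parent E rt w = v}"

definition homogeneous :: "('v \<Rightarrow> 'v \<Rightarrow> bool) \<Rightarrow> 'v \<Rightarrow> nat \<Rightarrow> bool" where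
  "homogeneous E rt \<gamma> \<longleftrightarrow> (\<forall>v. card (children E rt v) = \<gamma>)"

definition tderiv :: "('v \<Rightarrow> 'v \<Rightarrow> bool) \<Rightarrow> 'v \<Rightarrow> ('v \<Rightarrow> complex) \<Rightarrow> 'v \<Rightarrow> complex" where
  "tderiv E rt f v = (if v = rt then f rt else f v - f (parent E rt v))"

definition Lip :: "('v \<Rightarrow> 'v \<Rightarrow> bool) \<Rightarrow> 'v \<Rightarrow> ('v \<Rightarrow> complex) set" where
  "Lip E rt = {f. bounded (range (tderiv E rt f))}"

definition Lip_norm :: "('v \<Rightarrow> 'v \<Rightarrow> bool) \<Rightarrow> 'v \<Rightarrow> ('v \<Rightarrow> complex) \<Rightarrow> real" where
  "Lip_norm E rt f = (SUP v. norm (tderiv E rt f v))"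

definition bounded_operator_on_Lip ::
    "('v \<Rightarrow> 'v \<Rightarrow> bool) \<Rightarrow> 'v \<Rightarrow> (('v \<Rightarrow> complex) \<Rightarrow> 'v \<Rightarrow> complex) \<Rightarrow> bool" where
  "bounded_operator_on_Lip E rt A \<longleftrightarrow>
     (\<forall>f\<in>Lip E rt. A f \<in> Lip E rt) \<and>
     (\<forall>f\<in>Lip E rt. \<forall>g\<in>Lip E rt. A (\<lambda>v. f v + g v) = (\<lambda>v. A f v + A g v)) \<and>
     (\<forall>c. \<forall>f\<in>Lip E rt. A (\<lambda>v. c * f v) = (\<lambda>v. c * A f v)) \<and>
     (\<exists>K. \<forall>f\<in>Lip E rt. Lip_norm E rt (A f) \<le> K * Lip_norm E rt f)"

text \<open>
  The operator norm on the carrier \<open>Lip E rt\<close>. The supremum is a real one, so the value is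
  meaningful only together with \<open>bounded_operator_on_Lip\<close>.
\<close>

definition Lip_onorm ::
    "('v \<Rightarrow> 'v \<Rightarrow> bool) \<Rightarrow> 'v \<Rightarrow> (('v \<Rightarrow> complex) \<Rightarrow> 'v \<Rightarrow> complex) \<Rightarrow> real" where
  "Lip_onorm E rt A =
     (SUP f\<in>{f \<in> Lip E rt. f \<noteq> (\<lambda>_. 0)}. Lip_norm E rt (A f) / Lip_norm E rt f)"

definition backward_shift ::
    "('v \<Rightarrow> 'v \<Rightarrow> bool) \<Rightarrow> 'v \<Rightarrow> ('v \<Rightarrow> complex) \<Rightarrow> 'v \<Rightarrow> complex" where
  "backward_shift E rt f v = (\<Sum>w\<in>children E rt v. f w)"

end

theory Submission
  imports Defs
begin

text \<open>
  Write \<open>L\<close> for the Lipschitz norm of \<open>f\<close>, so that \<open>f\<close> changes by at most \<open>L\<close> along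
  every edge and \<open>\<bar>f rt\<bar> \<le> L\<close>. The number \<open>(B^n f) v\<close> is the sum of \<open>f\<close> over the \<open>\<gamma>^n\<close>
  descendants of \<open>v\<close> in the \<open>n\<close>-th generation below \<open>v\<close>, and the derivative of \<open>B^n f\<close> is
  estimated separately at the root and elsewhere.

  At the root, each of the \<open>\<gamma>^n\<close> terms has modulus at most \<open>(n + 1) L\<close>, which gives
  \<open>(n + 1) \<gamma>^n L\<close>.

  Now let \<open>v\<close> be a child of \<open>u\<close>. Then \<open>(B^n f) v - (B^n f) u\<close> is a sum of \<open>\<gamma>^n\<close> values
  in generation \<open>n\<close> below \<open>v\<close> minus a sum of \<open>\<gamma>^n\<close> values one level higher. Moving each
  of the former to the parent of its vertex costs one edge per term, altogether \<open>\<gamma>^n L\<close>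
  (\<open>funpow_B_consecutive\<close>), and leaves each of the \<open>\<gamma>^(n-1)\<close> values in generation \<open>n - 1\<close>
  below \<open>v\<close> counted \<open>\<gamma>\<close> times. Each of these values also occurs once in the subtracted sum and
  cancels. What remains is \<open>\<gamma>^n - \<gamma>^(n-1)\<close> values, with multiplicity, at depth \<open>n - 1\<close> below
  \<open>v\<close> against the same number of values at depth \<open>n\<close> below \<open>u\<close> but not below \<open>v\<close>. Vertices of
  these two kinds are at distance \<open>(n - 1) + 1 + n = 2 n\<close>, so the total is at most
  \<open>\<gamma>^n + 2 n (\<gamma>^n - \<gamma>^(n-1)) = (2 n + 1) \<gamma>^n - 2 n \<gamma>^(n-1)\<close> times \<open>L\<close>
  (\<open>funpow_B_edge_bound\<close>).

  For \<open>\<gamma> = 1\<close> the bound at the root dominates, and the function \<open>depth + 1\<close> attains it. For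
  \<open>\<gamma> \<ge> 2\<close> the other bound dominates. It is attained between the root and a chosen child \<open>v\<close>
  by the function equal to \<open>depth\<close> on \<open>v\<close> and its descendants and to \<open>- depth\<close> on all other
  vertices: it rises by \<open>1\<close> along every edge into or below \<open>v\<close> and falls by \<open>1\<close> along every
  other one, which makes every step of the estimate for this edge an equality.

  The iterates are never expanded into sums over generations: all estimates go through
  the recursion \<open>(B^(n+1) f) v = (\<Sum>x\<in>Chi v. (B^n f) x)\<close>.
\<close>

section \<open>The parent structure of a rooted tree\<close>

locale homogeneous_tree =
  fixes E :: "'v \<Rightarrow> 'v \<Rightarrow> bool" and rt :: 'v and \<gamma> :: nat
  assumes tree: "loc_finite_inf_tree E"
    and homog: "homogeneous E rt \<gamma>"
begin

abbreviation "par \<equiv> parent E rt"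
abbreviation "Chi \<equiv> children E rt"
abbreviation "B \<equiv> backward_shift E rt"
abbreviation "D \<equiv> tderiv E rt"

definition root_path :: "'v \<Rightarrow> 'v list" where
  "root_path v = (THE p. path_between E rt v p)"

definition depth :: "'v \<Rightarrow> nat" where
  "depth v = length (root_path v) - 1"

lemma ex1_path: "\<exists>!p. path_between E u v p"
  using tree by (simp add: loc_finite_inf_tree_def is_tree_def)

lemma path_between_root_path: "path_between E rt v (root_path v)"
  unfolding root_path_def using ex1_path by (rule theI')

lemma root_path_eqI: "path_between E rt v p \<Longrightarrow> root_path v = p"
  unfolding root_path_def using ex1_path by (rule the1_equality)

lemma root_path_root: "root_path rt = [rt]"
  by (rule root_path_eqI) (simp add: path_between_def)

text \<open>
  By uniqueness of paths, deleting the last vertex of the path to \<open>v\<close> leaves the path to its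
  parent. Hence depth and descent from a given vertex obey recursions along \<open>par\<close>.
\<close>

lemma root_path_parent:
  assumes "v \<noteq> rt"
  shows "root_path v = root_path (par v) @ [v]" and "E (par v) v"
proof -
  let ?p = "root_path v" and ?q = "butlast (root_path v)"
  have p: "?p \<noteq> []" "hd ?p = rt" "last ?p = v" "distinct ?p" "successively E ?p"
    using path_between_root_path[of v] by (auto simp: path_between_def)
  have split: "?p = ?q @ [v]"
    using p(1,3) append_butlast_last_id[of ?p] by simp
  have q: "?q \<noteq> []"
    using split p(2) assms by (metis append_Nil list.sel(1))
  have par: "par v = last ?q"
    by (simp add: parent_def root_path_def)
  have suc: "successively E ?q \<and> E (last ?q) v"
    using p(5) q split by (metis successively_append_iff list.sel(1) not_Cons_self2)
  have "path_between E rt (par v) ?q"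
    unfolding path_between_def par
    using q p(2,4) suc split by (metis distinct_butlast hd_append2)
  from root_path_eqI[OF this] split show "root_path v = root_path (par v) @ [v]"
    by simp
  show "E (par v) v"
    using suc par by simp
qed

lemma root_path_child: "w \<in> Chi v \<Longrightarrow> root_path w = root_path v @ [w]"
  using root_path_parent(1) by (auto simp: children_def)

lemma depth_root: "depth rt = 0"
  by (simp add: depth_def root_path_root)

lemma depth_child: "w \<in> Chi v \<Longrightarrow> depth w = Suc (depth v)"
proof -
  assume "w \<in> Chi v"
  moreover have "root_path v \<noteq> []"
    using path_between_root_path[of v] by (simp add: path_between_def)
  ultimately show ?thesis
    by (cases "root_path v") (simp_all add: depth_def root_path_child)
qed

lemma in_Chi_par: "v \<noteq> rt \<Longrightarrow> v \<in> Chi (par v)"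
  by (simp add: children_def)

lemma finite_Chi: "finite (Chi v)"
proof (rule finite_subset)
  show "Chi v \<subseteq> {w. E v w}"
    using root_path_parent(2) by (auto simp: children_def)
  show "finite {w. E v w}"
    using tree by (simp add: loc_finite_inf_tree_def)
qed

lemma card_Chi: "card (Chi v) = \<gamma>"
  using homog by (simp add: homogeneous_def)

text \<open>A vertex other than the root exists because the tree is infinite, and it is a child.\<close>

lemma gamma_ge_1: "\<gamma> \<ge> 1"
proof -
  have "infinite (UNIV :: 'v set)"
    using tree by (simp add: loc_finite_inf_tree_def)
  then obtain w where "w \<noteq> rt"
    by (metis (full_types) UNIV_I finite.emptyI finite_insert finite_subset insertI1 subsetI)
  from in_Chi_par[OF this] have "card (Chi (par w)) > 0"
    using finite_Chi card_gt_0_iff by blast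
  then show ?thesis by (simp add: card_Chi)
qed


section \<open>Iterates of the backward shift\<close>

lemma funpow_B_Suc: "(B ^^ Suc n) f v = (\<Sum>x\<in>Chi v. (B ^^ n) f x)"
  by (simp add: backward_shift_def)

lemma funpow_B_add: "(B ^^ n) (\<lambda>v. f v + g v) = (\<lambda>v. (B ^^ n) f v + (B ^^ n) g v)"
  by (induction n) (simp_all add: backward_shift_def fun_eq_iff sum.distrib)

lemma funpow_B_scale: "(B ^^ n) (\<lambda>v. c * f v) = (\<lambda>v. c * (B ^^ n) f v)"
  by (induction n) (simp_all add: backward_shift_def fun_eq_iff sum_distrib_left)

text \<open>
  On a part of the tree where \<open>f\<close> grows by the same amount along every edge, \<open>f\<close> takes a single
  value on each generation of descendants of \<open>x\<close>; this evaluates the extremal functions.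
\<close>

lemma funpow_B_arithmetic:
  assumes closed: "\<And>x y. x \<in> S \<Longrightarrow> y \<in> Chi x \<Longrightarrow> y \<in> S"
    and step: "\<And>x y. x \<in> S \<Longrightarrow> y \<in> Chi x \<Longrightarrow> f y = f x + c"
    and "x \<in> S"
  shows "(B ^^ n) f x = of_nat \<gamma> ^ n * (f x + of_nat n * c)"
  using \<open>x \<in> S\<close>
proof (induction n arbitrary: x)
  case 0
  then show ?case by simp
next
  case (Suc n)
  have "(B ^^ Suc n) f x = (\<Sum>y\<in>Chi x. of_nat \<gamma> ^ n * (f x + c + of_nat n * c))"
    unfolding funpow_B_Suc using Suc closed step by (intro sum.cong) simp_all
  then show ?case by (simp add: card_Chi algebra_simps)
qed


section \<open>Upper bounds\<close>

lemma norm_sum_Chi_le: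
  assumes "\<And>x. x \<in> Chi v \<Longrightarrow> norm (h x :: complex) \<le> b"
  shows "norm (\<Sum>x\<in>Chi v. h x) \<le> real \<gamma> * b"
  using sum_norm_bound[of "Chi v" h b] assms by (simp add: card_Chi)

context
  fixes f :: "'v \<Rightarrow> complex" and L :: real
  assumes edge: "\<And>u v. v \<in> Chi u \<Longrightarrow> norm (f v - f u) \<le> L"
begin

text \<open>Each of the \<open>\<gamma>^n\<close> descendants involved is joined to \<open>v\<close> by \<open>n\<close> edges.\<close>

lemma funpow_B_diff_value:
  "norm ((B ^^ n) f v - of_nat \<gamma> ^ n * f v) \<le> real n * real \<gamma> ^ n * L"
proof (induction n arbitrary: v)
  case 0
  then show ?case by simp
next
  case (Suc n)
  have "norm (((B ^^ n) f x - of_nat \<gamma> ^ n * f x) + of_nat \<gamma> ^ n * (f x - f v))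
      \<le> (real n + 1) * real \<gamma> ^ n * L" if "x \<in> Chi v" for x
  proof -
    have "norm (of_nat \<gamma> ^ n * (f x - f v)) \<le> real \<gamma> ^ n * L"
      using edge[OF that] by (simp add: norm_mult norm_power mult_left_mono)
    from norm_triangle_mono[OF Suc.IH[of x] this] show ?thesis
      by (simp add: algebra_simps)
  qed
  from norm_sum_Chi_le[OF this]
  have "norm (\<Sum>x\<in>Chi v. (B ^^ n) f x - of_nat \<gamma> ^ n * f v)
      \<le> real \<gamma> * ((real n + 1) * real \<gamma> ^ n * L)"
    by (simp add: algebra_simps)
  then show ?case
    unfolding funpow_B_Suc by (simp add: sum_subtractf card_Chi algebra_simps)
qed

text \<open>
  Each of the \<open>\<gamma>^(n+1)\<close> vertices in generation \<open>n + 1\<close> is compared with its own parent, at the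
  cost of one edge.
\<close>

lemma funpow_B_consecutive:
  "norm ((B ^^ Suc n) f v - of_nat \<gamma> * (B ^^ n) f v) \<le> real \<gamma> ^ Suc n * L"
proof (induction n arbitrary: v)
  case 0
  show ?case using funpow_B_diff_value[of 1 v] by simp
next
  case (Suc n)
  have "norm (\<Sum>x\<in>Chi v. (B ^^ Suc n) f x - of_nat \<gamma> * (B ^^ n) f x)
      \<le> real \<gamma> * (real \<gamma> ^ Suc n * L)"
    using Suc by (rule norm_sum_Chi_le)
  then show ?case
    unfolding funpow_B_Suc[of "Suc n" f v] funpow_B_Suc[of n f v]
    by (simp add: sum_subtractf sum_distrib_left mult.assoc)
qed

text \<open>
  The coefficient \<open>2 (m + 1)\<close> arises as \<open>m + 1 + (m + 1)\<close>: the values at depth \<open>m\<close> below \<open>v\<close>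
  are brought to \<open>v\<close>, then across the edge to \<open>u\<close>, and the values at depth \<open>m + 1\<close> below \<open>u\<close>
  are brought to \<open>u\<close>.
\<close>

lemma funpow_B_edge_bound:
  assumes v: "v \<in> Chi u"
  shows "norm ((B ^^ Suc m) f v - (B ^^ Suc m) f u)
    \<le> (real \<gamma> ^ Suc m + 2 * real (Suc m) * (real \<gamma> - 1) * real \<gamma> ^ m) * L"
proof -
  let ?g = "of_nat \<gamma> :: complex" and ?S = "Chi u - {v}"
  let ?a = "(B ^^ Suc m) f v - ?g * (B ^^ m) f v"
  let ?b = "(?g - 1) * ((B ^^ m) f v - ?g ^ m * f v)"
  let ?c = "(?g - 1) * ?g ^ m * (f v - f u)"
  let ?d = "\<Sum>x\<in>?S. (B ^^ m) f x - ?g ^ m * f u"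
  have g1: "?g - 1 = of_real (real \<gamma> - 1)" "real \<gamma> - 1 \<ge> 0"
    using gamma_ge_1 by simp_all
  have cardS: "real (card ?S) = real \<gamma> - 1"
    using v gamma_ge_1 by (simp add: card_Chi finite_Chi of_nat_diff)
  (* The term of the parent's sum that lies below v is cancelled against the sum for v;
     the values at the two ends of the edge serve as reference levels for what remains. *)
  have "(B ^^ Suc m) f u = (B ^^ m) f v + (\<Sum>x\<in>?S. (B ^^ m) f x)"
    unfolding funpow_B_Suc using v by (simp add: finite_Chi sum.remove)
  also have "(\<Sum>x\<in>?S. (B ^^ m) f x) = ?d + of_nat (card ?S) * (?g ^ m * f u)"
    by (simp add: sum_subtractf)
  also have "(of_nat (card ?S) :: complex) = ?g - 1"
    using cardS by (metis g1(1) of_real_of_nat_eq)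
  finally have eq: "(B ^^ Suc m) f v - (B ^^ Suc m) f u = ?a + ?b + ?c - ?d"
    by (simp add: algebra_simps)
  have b: "norm ?b \<le> (real \<gamma> - 1) * (real m * real \<gamma> ^ m * L)"
    unfolding norm_mult g1(1) norm_of_real abs_of_nonneg[OF g1(2)]
    by (rule mult_left_mono[OF funpow_B_diff_value g1(2)])
  have c: "norm ?c \<le> (real \<gamma> - 1) * real \<gamma> ^ m * L"
    unfolding norm_mult g1(1) norm_of_real abs_of_nonneg[OF g1(2)] norm_power norm_of_nat
    by (rule mult_left_mono[OF edge[OF v]]) (use g1(2) in simp)
  have "norm ((B ^^ m) f x - ?g ^ m * f u) \<le> real (Suc m) * real \<gamma> ^ m * L"
    if "x \<in> ?S" for x
  proof -
    have "norm (?g ^ m * (f x - f u)) \<le> real \<gamma> ^ m * L"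
      using edge[of x u] that by (simp add: norm_mult norm_power mult_left_mono)
    from norm_triangle_mono[OF funpow_B_diff_value[of m x] this] show ?thesis
      by (simp add: algebra_simps)
  qed
  then have d: "norm ?d \<le> (real \<gamma> - 1) * (real (Suc m) * real \<gamma> ^ m * L)"
    using sum_norm_bound[of ?S] cardS by metis
  have "norm (?a + ?b + ?c - ?d) \<le> norm ?a + norm ?b + norm ?c + norm ?d"
    using norm_triangle_ineq4[of "?a + ?b + ?c" ?d] norm_triangle_ineq[of "?a + ?b" ?c]
      norm_triangle_ineq[of ?a ?b] by linarith
  also have "\<dots> \<le> real \<gamma> ^ Suc m * L + (real \<gamma> - 1) * (real m * real \<gamma> ^ m * L)
      + (real \<gamma> - 1) * real \<gamma> ^ m * L + (real \<gamma> - 1) * (real (Suc m) * real \<gamma> ^ m * L)"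
    using funpow_B_consecutive b c d by (intro add_mono)
  also have "\<dots> = (real \<gamma> ^ Suc m + 2 * real (Suc m) * (real \<gamma> - 1) * real \<gamma> ^ m) * L"
    by (simp add: algebra_simps)
  finally show ?thesis unfolding eq .
qed

end

lemma tderiv_le_Lip_norm:
  assumes "f \<in> Lip E rt"
  shows "norm (D f v) \<le> Lip_norm E rt f"
  unfolding Lip_norm_def
proof (rule cSUP_upper)
  show "bdd_above (range (\<lambda>v. norm (D f v)))"
    using assms by (auto simp: Lip_def bounded_iff bdd_above_def)
qed simp

lemma Lip_norm_leI: "(\<And>v. norm (D f v) \<le> c) \<Longrightarrow> Lip_norm E rt f \<le> c"
  unfolding Lip_norm_def by (rule cSUP_least) simp_all

lemma LipI: "(\<And>v. norm (D f v) \<le> c) \<Longrightarrow> f \<in> Lip E rt"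
  by (auto simp: Lip_def bounded_iff)

lemma tderiv_child: "v \<in> Chi u \<Longrightarrow> D f v = f v - f u"
  by (auto simp: children_def tderiv_def)

definition root_bound :: "nat \<Rightarrow> real" where
  "root_bound n = (real n + 1) * real \<gamma> ^ n"

definition edge_bound :: "nat \<Rightarrow> real" where
  "edge_bound n = (2 * real n + 1) * real \<gamma> ^ n - 2 * real n * real \<gamma> ^ (n - 1)"

lemma tderiv_funpow_B_bound:
  assumes f: "f \<in> Lip E rt" and n: "n \<ge> 1"
  shows "norm (D ((B ^^ n) f) v) \<le> max (root_bound n) (edge_bound n) * Lip_norm E rt f"
proof -
  let ?L = "Lip_norm E rt f"
  have L0: "?L \<ge> 0"
    using tderiv_le_Lip_norm[OF f, of rt] norm_ge_zero[of "D f rt"] by linarith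
  have edge: "norm (f w - f u) \<le> ?L" if "w \<in> Chi u" for u w
    using tderiv_le_Lip_norm[OF f, of w] tderiv_child[OF that] by metis
  show ?thesis
  proof (cases "v = rt")
    case True
    have "norm (of_nat \<gamma> ^ n * f rt) \<le> real \<gamma> ^ n * ?L"
      using tderiv_le_Lip_norm[OF f, of rt]
      by (simp add: tderiv_def norm_mult norm_power mult_left_mono)
    from norm_triangle_mono[OF funpow_B_diff_value[where f = f, OF edge, where n = n and v = rt] this]
    have "norm (D ((B ^^ n) f) v) \<le> root_bound n * ?L"
      using True by (simp add: tderiv_def root_bound_def algebra_simps)
    also have "\<dots> \<le> max (root_bound n) (edge_bound n) * ?L"
      using L0 by (simp add: mult_right_mono)
    finally show ?thesis .
  next
    case False
    obtain m where m: "n = Suc m"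
      using n by (cases n) simp_all
    have "norm (D ((B ^^ n) f) v) \<le> edge_bound n * ?L"
      using funpow_B_edge_bound[where f = f, OF edge in_Chi_par[OF False], where m = m]
      by (simp add: tderiv_child[OF in_Chi_par[OF False]] edge_bound_def m algebra_simps)
    also have "\<dots> \<le> max (root_bound n) (edge_bound n) * ?L"
      using L0 by (simp add: mult_right_mono)
    finally show ?thesis .
  qed
qed

lemma bounded_operator_funpow_B:
  assumes "n \<ge> 1"
  shows "bounded_operator_on_Lip E rt (B ^^ n)"
  unfolding bounded_operator_on_Lip_def
  using LipI[OF tderiv_funpow_B_bound[OF _ assms]]
    Lip_norm_leI[OF tderiv_funpow_B_bound[OF _ assms]]
  by (auto simp: funpow_B_add funpow_B_scale)


section \<open>Attainment\<close>

text \<open>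
  A function of norm at most \<open>1\<close> whose image has derivative of modulus \<open>K > 0\<close> at a single
  vertex suffices: the upper bound then forces its norm to be exactly \<open>1\<close>.
\<close>

lemma Lip_onorm_eqI:
  assumes n: "n \<ge> 1"
    and K: "max (root_bound n) (edge_bound n) = K" and K0: "K > 0"
    and Df: "\<And>w. norm (D f w) \<le> 1"
    and att: "norm (D ((B ^^ n) f) v) = K"
  shows "Lip_onorm E rt (B ^^ n) = K"
proof -
  let ?X = "{f \<in> Lip E rt. f \<noteq> (\<lambda>_. 0)}"
  let ?q = "\<lambda>f. Lip_norm E rt ((B ^^ n) f) / Lip_norm E rt f"
  have upper: "?q g \<le> K" if g: "g \<in> Lip E rt" for g
  proof -
    have "Lip_norm E rt ((B ^^ n) g) \<le> K * Lip_norm E rt g"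
      using tderiv_funpow_B_bound[OF g n] K by (intro Lip_norm_leI) simp
    moreover have "Lip_norm E rt g \<ge> 0"
      using tderiv_le_Lip_norm[OF g, of rt] norm_ge_zero[of "D g rt"] by linarith
    ultimately show ?thesis
      using K0 by (cases "Lip_norm E rt g = 0") (simp_all add: divide_le_eq)
  qed
  have f: "f \<in> Lip E rt" using LipI Df .
  have Bf: "(B ^^ n) f \<in> Lip E rt"
    using LipI[OF tderiv_funpow_B_bound[OF f n]] .
  have K_le: "K \<le> Lip_norm E rt ((B ^^ n) f)"
    using tderiv_le_Lip_norm[OF Bf, of v] att by simp
  have "K \<le> K * Lip_norm E rt f"
    using tderiv_funpow_B_bound[OF f n, of v] att K by simp
  then have "Lip_norm E rt f \<ge> 1"
    using K0 by simp
  moreover have "Lip_norm E rt f \<le> 1"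
    using Df by (rule Lip_norm_leI)
  ultimately have norm_f: "Lip_norm E rt f = 1" by simp
  then have "f \<noteq> (\<lambda>_. 0)"
    by (auto simp: Lip_norm_def tderiv_def cong: if_cong)
  with f have fX: "f \<in> ?X" by simp
  show ?thesis
    unfolding Lip_onorm_def
  proof (rule antisym)
    show "(SUP f\<in>?X. ?q f) \<le> K"
      using fX upper by (intro cSUP_least) auto
    have "?q f \<le> (SUP f\<in>?X. ?q f)"
      using fX upper by (intro cSUP_upper) (auto simp: bdd_above_def)
    with K_le norm_f show "K \<le> (SUP f\<in>?X. ?q f)" by simp
  qed
qed

lemma norm_tderivI:
  assumes "norm (f rt) \<le> c" and "\<And>u w. w \<in> Chi u \<Longrightarrow> norm (f w - f u) \<le> c"
  shows "norm (D f v) \<le> c"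
  using assms in_Chi_par[of v] by (auto simp: tderiv_def)

lemma Lip_onorm_funpow_B_unary:
  assumes n: "n \<ge> 1" and \<gamma>: "\<gamma> = 1"
  shows "Lip_onorm E rt (B ^^ n) = real n + 1"
proof (rule Lip_onorm_eqI[OF n])
  let ?f = "\<lambda>v. of_nat (Suc (depth v)) :: complex"
  show "max (root_bound n) (edge_bound n) = real n + 1"
    unfolding root_bound_def edge_bound_def using \<gamma> by simp
  show "norm (D ?f w) \<le> 1" for w
    by (rule norm_tderivI) (simp_all add: depth_root depth_child)
  have "(B ^^ n) ?f rt = of_nat \<gamma> ^ n * (?f rt + of_nat n * 1)"
    by (rule funpow_B_arithmetic[where S = UNIV]) (simp_all add: depth_child)
  also have "\<dots> = of_real (real n + 1)"
    by (simp add: \<gamma> depth_root)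
  finally have "D ((B ^^ n) ?f) rt = of_real (real n + 1)"
    by (simp only: tderiv_def if_True simp_thms)
  then show "norm (D ((B ^^ n) ?f) rt) = real n + 1"
    by (simp only: norm_of_real)
qed simp

text \<open>
  The set \<open>?S\<close> consists of \<open>v\<close> and its descendants. Its complement is closed under taking children
  only once the root is removed, since \<open>v\<close> itself is a child of the root; the value at the root is
  therefore computed from those at its children.
\<close>

lemma Lip_onorm_funpow_B_branching:
  assumes n: "n \<ge> 1" and \<gamma>: "\<gamma> \<ge> 2"
  shows "Lip_onorm E rt (B ^^ n) = edge_bound n"
proof -
  obtain m where m: "n = Suc m"
    using n by (cases n) simp_all
  have "Chi rt \<noteq> {}"
    using card_Chi[of rt] \<gamma> by auto
  then obtain v where v: "v \<in> Chi rt" by auto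
  then have "v \<noteq> rt" by (simp add: children_def)
  let ?S = "{w. v \<in> set (root_path w)}"
  define f :: "'v \<Rightarrow> complex"
    where "f w = (if w \<in> ?S then 1 else - 1) * of_nat (depth w)" for w
  have S_v: "v \<in> ?S" and S_rt: "rt \<notin> ?S"
    using root_path_child[OF v] \<open>v \<noteq> rt\<close> by (simp_all add: root_path_root)
  have S_child: "y \<in> ?S \<longleftrightarrow> x \<in> ?S \<or> y = v" if "y \<in> Chi x" for x y
    using root_path_child[OF that] by auto
  have v_child: "x = rt" if "v \<in> Chi x" for x
    using that v by (simp add: children_def)

  have "norm (D f w) \<le> 1" for w
  proof (rule norm_tderivI)
    show "norm (f rt) \<le> 1" by (simp add: f_def depth_root)
  next
    fix u y assume y: "y \<in> Chi u"
    show "norm (f y - f u) \<le> 1"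
    proof (cases "y = v")
      case True
      with y v_child have "u = rt" by simp
      with True show ?thesis
        using S_v by (simp add: f_def depth_child[OF v] depth_root)
    next
      case False
      then have "y \<in> ?S \<longleftrightarrow> u \<in> ?S"
        using S_child[OF y] by simp
      then have "f y - f u = (if u \<in> ?S then 1 else - 1)"
        by (simp add: f_def depth_child[OF y] algebra_simps)
      then show ?thesis by simp
    qed
  qed
  moreover have "norm (D ((B ^^ n) f) v) = edge_bound n"
  proof -
    have inside: "(B ^^ k) f x = of_nat \<gamma> ^ k * (f x + of_nat k * 1)" if "x \<in> ?S" for k x
    proof (rule funpow_B_arithmetic[of ?S])
      fix x y assume "x \<in> ?S" "y \<in> Chi x"
      then show "y \<in> ?S" "f y = f x + 1"
        using S_child[of y x] by (simp_all add: f_def depth_child)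
    qed (fact that)
    have outside: "(B ^^ k) f x = of_nat \<gamma> ^ k * (f x + of_nat k * (- 1))"
      if "x \<in> - ?S - {rt}" for k x
    proof (rule funpow_B_arithmetic[of "- ?S - {rt}"])
      fix x y assume x: "x \<in> - ?S - {rt}" and y: "y \<in> Chi x"
      have "y \<noteq> v" using x y v_child by auto
      then have yS: "y \<notin> ?S" using S_child[OF y] x by simp
      moreover have "y \<noteq> rt" using y by (simp add: children_def)
      ultimately show "y \<in> - ?S - {rt}" by simp
      show "f y = f x + - 1"
        using x yS by (simp add: f_def depth_child[OF y])
    qed (fact that)
    let ?g = "of_nat \<gamma> :: complex"
    have f_v: "f v = 1"
      using S_v by (simp add: f_def depth_child[OF v] depth_root)
    have other: "(B ^^ m) f x = - (?g ^ m * of_nat (Suc m))" if "x \<in> Chi rt - {v}" for x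
    proof -
      have "x \<notin> ?S" "x \<noteq> rt"
        using that S_child[of x rt] S_rt by (auto simp: children_def)
      then have "(B ^^ m) f x = ?g ^ m * (- 1 + of_nat m * (- 1))"
        using outside[of x m] that by (simp add: f_def depth_child[of x rt] depth_root)
      also have "\<dots> = - (?g ^ m * of_nat (Suc m))"
        by (simp add: algebra_simps)
      finally show ?thesis .
    qed
    have "(B ^^ n) f rt = (B ^^ m) f v + (\<Sum>x\<in>Chi rt - {v}. (B ^^ m) f x)"
      unfolding m funpow_B_Suc using v by (simp add: finite_Chi sum.remove)
    also have "(\<Sum>x\<in>Chi rt - {v}. (B ^^ m) f x) = - ((?g - 1) * (?g ^ m * of_nat (Suc m)))"
      using other v \<gamma> by (simp add: card_Chi finite_Chi of_nat_diff)
    also have "(B ^^ m) f v = ?g ^ m * of_nat (Suc m)"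
      using inside[OF S_v, of m] by (simp add: f_v)
    finally have "(B ^^ n) f v - (B ^^ n) f rt
        = ?g ^ n * of_nat (Suc n) - (?g ^ m * of_nat (Suc m) + - ((?g - 1) * (?g ^ m * of_nat (Suc m))))"
      using inside[OF S_v, of n] by (simp add: f_v)
    also have "\<dots> = of_real (edge_bound n)"
      by (simp add: edge_bound_def m algebra_simps)
    finally have "D ((B ^^ n) f) v = of_real (edge_bound n)"
      by (simp add: tderiv_child[OF v])
    moreover have "edge_bound n \<ge> 0"
    proof -
      have "edge_bound n = real \<gamma> ^ m * (2 * real n * (real \<gamma> - 1) + real \<gamma>)"
        by (simp add: edge_bound_def m algebra_simps)
      then show ?thesis using \<gamma> by simp
    qed
    ultimately show ?thesis by simp
  qed
  moreover have "root_bound n \<le> edge_bound n"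
  proof -
    have "edge_bound n - root_bound n = real n * real \<gamma> ^ m * (real \<gamma> - 2)"
      by (simp add: edge_bound_def root_bound_def m algebra_simps)
    also have "\<dots> \<ge> 0" using \<gamma> by simp
    finally show ?thesis by simp
  qed
  moreover have "root_bound n > 0"
    using \<gamma> by (simp add: root_bound_def)
  ultimately show ?thesis
    by (intro Lip_onorm_eqI[OF n]) (simp_all add: max_def)
qed

end


section \<open>The norm of the iterated backward shift\<close>

theorem theorem5p4:
  fixes E :: "'v \<Rightarrow> 'v \<Rightarrow> bool" and rt :: 'v and \<gamma> n :: nat
  assumes "loc_finite_inf_tree E"
    and "homogeneous E rt \<gamma>"
    and "n \<ge> 1"
  shows "bounded_operator_on_Lip E rt (backward_shift E rt ^^ n) \<and>
    (\<gamma> = 1 \<longrightarrow> Lip_onorm E rt (backward_shift E rt ^^ n) = real n + 1) \<and>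
    (\<gamma> \<ge> 2 \<longrightarrow> Lip_onorm E rt (backward_shift E rt ^^ n) =
       (2 * real n + 1) * real \<gamma> ^ n - 2 * real n * real \<gamma> ^ (n - 1))"
proof -
  interpret homogeneous_tree E rt \<gamma>
    using assms(1,2) by unfold_locales
  show ?thesis
    using bounded_operator_funpow_B Lip_onorm_funpow_B_unary Lip_onorm_funpow_B_branching assms(3)
    by (simp add: edge_bound_def)
qed

end
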